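(* Let $\gamma,\beta\in(0,\infty)$. There exist a kernel function $f^*(\cdot\,;\gamma,\beta)\in L_o^2(\phi)$ that is everywhere continuous, twice differentiable except at finitely many points, with $|f^*|,|(f^* )'|,|(f^* )''|\le ce^{c|x|}$ for some $c>0$ whenever they exist, and a critical value $\lambda_*(\gamma,\beta)$ such that $$\bigcup_{f\in L^2_o(\phi)}\mathcal R(f,\gamma,\beta,\cdot)=\mathcal R\big(f^*(\cdot\,;\gamma,\beta),\gamma,\beta,\cdot\big)=(\lambda_*(\gamma,\beta),\infty).$$ The kernel $f^*(\cdot\,;\gamma,\beta)$ is of the form $$f^*(x;\gamma,\beta)=a_1^*(\gamma,\beta)\,x+\beta\,g(x;\gamma,\beta),$$ where $a_1^*(\gamma,\beta)$ denotes the coefficient of $h_1$ in the Hermite expansion of $f^*(\cdot\,;\gamma,\beta)$ and $$g(x;\gamma,\beta)=e^{-t^2/2}\sinh(tx)-tx,\qquad t:=\frac{\lambda_*(\gamma,\beta)-1}{\beta}.$$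
   Context: $\phi(z)=(2\pi)^{-1/2}e^{-z^2/2}$, $\langle f,g\rangle_\phi=\int fg\,\phi$, $\|f\|_\phi^2=\langle f,f\rangle_\phi$; $L^2_o(\phi)$ is the set of odd functions $f:\mathbb R\to\mathbb R$ with $\|f\|_\phi<\infty$; $\{h_k\}$ are the Hermite polynomials normalized so that $\langle h_k,h_\ell\rangle_\phi=\mathbf 1_{k=\ell}$ (positive leading coefficient; $h_1(x)=x$). For $f\in L_o^2(\phi)$ with $a_k:=\langle f,h_k\rangle_\phi$, $\tau(f,\beta,\lambda):=\sum_{\ell\ge3}\frac{a_\ell(\lambda-1)^\ell}{\sqrt{\ell!}\,\beta^{\ell-1}}$. (The function $g(\cdot\,;\gamma,\beta)$ is the one with Hermite coefficients $(\lambda_*(\gamma,\beta)-1)^k/(\sqrt{k!}\,\beta^k)$ for odd $k\ge3$ and zero otherwise.) Recovery region. $\mathcal R(f,\gamma,\beta,\cdot)$ is the set of $\lambda>1$ such that, with $\tau=\tau(f,\beta,\lambda)$: either $a_1>0$ and $\psi'(s_+)>0$, where $$\psi'(s)=\frac1{s^2}-\frac{a_1^2\gamma}{(1+a_1\gamma s)^2}-\gamma(\|f\|_\phi^2-a_1^2),\qquad s_+=\frac{-a_1(\lambda+\gamma-1)-\tau+\sqrt{(a_1(\lambda+\gamma-1)+\tau)^2-4a_1\gamma\tau}}{2a_1\gamma\tau}$$ (with $s_+=-1/(a_1(\lambda+\gamma-1))$, the limit of this expression, if $\tau=0$); or $a_1=0$ and $\tau>\sqrt\gamma\,\|f\|_\phi$.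 (If $a_1<0$ the set is empty.) *)

theory Defs
  imports "HOL-Probability.Probability" "HOL-Computational_Algebra.Polynomial"
begin

section \<open>The space of odd functions in the Gaussian $L^2$\<close>

definition gauss_inner :: "(real \<Rightarrow> real) \<Rightarrow> (real \<Rightarrow> real) \<Rightarrow> real" where
  "gauss_inner f g = (LINT x|lebesgue. f x * g x * std_normal_density x)"

definition gauss_norm :: "(real \<Rightarrow> real) \<Rightarrow> real" where
  "gauss_norm f = sqrt (gauss_inner f f)"

text \<open>The Bochner integral of a non-integrable function is \<open>0\<close>, so finiteness of the norm has to be
  expressed by integrability.\<close>

definition L2_odd :: "(real \<Rightarrow> real) set" where
  "L2_odd = {f. (\<forall>x. f (- x) = - f x) \<and> f \<in> borel_measurable lebesgue \<and>
                integrable lebesgue (\<lambda>x. (f x)\<^sup>2 * std_normal_density x)}"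


section \<open>Hermite polynomials\<close>

fun Herm :: "nat \<Rightarrow> real poly" where
  "Herm 0 = 1"
| "Herm (Suc 0) = [:0, 1:]"
| "Herm (Suc (Suc n)) = [:0, 1:] * Herm (Suc n) - smult (real (Suc n)) (Herm n)"

text \<open>The polynomials \<open>Herm k\<close> are the monic (probabilists') Hermite polynomials.  After division by
  \<open>sqrt (fact k)\<close> they are orthonormal for the standard Gaussian weight, with positive leading
  coefficient; both facts are proved below.\<close>

definition hermite :: "nat \<Rightarrow> real \<Rightarrow> real" where
  "hermite k x = poly (Herm k) x / sqrt (fact k)"

definition hermite_coeff :: "(real \<Rightarrow> real) \<Rightarrow> nat \<Rightarrow> real" where
  "hermite_coeff f k = gauss_inner f (hermite k)"

lemma degree_lead_coeff_Herm: "degree (Herm n) = n \<and> lead_coeff (Herm n) = 1"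
proof (induction n rule: Herm.induct)
  case (3 n)
  have a: "degree ([:0, 1:] * Herm (Suc n)) = Suc (Suc n)"
    using 3 by (subst degree_mult_eq) auto
  have b: "degree (smult (real (Suc n)) (Herm n)) < Suc (Suc n)"
    using 3 by simp
  have d: "degree (Herm (Suc (Suc n))) = Suc (Suc n)"
    using a b by (simp add: diff_conv_add_uminus degree_add_eq_left del: add_uminus_conv_diff)
  have "coeff (Herm (Suc (Suc n))) (Suc (Suc n)) = 1"
  proof -
    have "coeff (Herm (Suc n)) (Suc n) = 1" using 3(1) by metis
    moreover have "coeff (Herm n) (Suc (Suc n)) = 0" using 3(2) by (simp add: coeff_eq_0)
    ultimately show ?thesis by simp
  qed
  with d show ?case by simp
qed auto

lemma pderiv_Herm_Suc: "pderiv (Herm (Suc n)) = smult (real (Suc n)) (Herm n)"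
proof (induction n rule: less_induct)
  case (less n)
  show ?case
  proof (cases n)
    case 0
    then show ?thesis by (simp add: pderiv_pCons)
  next
    case (Suc m)
    show ?thesis
    proof (cases m)
      case 0
      then show ?thesis using Suc by (simp add: pderiv_pCons)
    next
      case (Suc k)
      have n: "n = Suc (Suc k)" using Suc \<open>n = Suc m\<close> by simp
      have d1: "pderiv (Herm (Suc (Suc k))) = smult (real (Suc (Suc k))) (Herm (Suc k))"
        using less[of "Suc k"] n by simp
      have d2: "pderiv (Herm (Suc k)) = smult (real (Suc k)) (Herm k)"
        using less[of k] n by simp
      have "pderiv (Herm (Suc n)) = Herm (Suc (Suc k)) + [:0, 1:] * pderiv (Herm (Suc (Suc k)))
          - smult (real (Suc (Suc k))) (pderiv (Herm (Suc k)))"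
        unfolding n Herm.simps(3)[of "Suc k"]
        by (simp only: pderiv_diff pderiv_mult pderiv_smult) (simp add: pderiv_pCons)
      also have "\<dots> = Herm (Suc (Suc k)) + smult (real (Suc (Suc k)))
          ([:0, 1:] * Herm (Suc k) - smult (real (Suc k)) (Herm k))"
        unfolding d1 d2 by (simp add: smult_diff_right algebra_simps)
      also have "\<dots> = smult (real (Suc n)) (Herm n)"
      proof -
        have "smult (real (Suc n)) (Herm n) = Herm n + smult (real n) (Herm n)"
          using smult_add_left[of 1 "real n" "Herm n"] by simp
        then show ?thesis unfolding n Herm.simps(3)[symmetric] by (simp only:)
      qed
      finally show ?thesis .
    qed
  qed
qed

lemma Herm_Suc: "Herm (Suc n) = [:0, 1:] * Herm n - pderiv (Herm n)"
  by (cases n) (simp_all add: pderiv_Herm_Suc)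

definition gauss_mean :: "real poly \<Rightarrow> real" where
  "gauss_mean p = (LINT x|lborel. poly p x * std_normal_density x)"

lemma integrable_poly_gauss: "integrable lborel (\<lambda>x. poly p x * std_normal_density x)"
proof -
  have "integrable lborel (\<lambda>x. \<Sum>i\<le>degree p. coeff p i * (std_normal_density x * x ^ i))"
    by (intro Bochner_Integration.integrable_sum integrable_mult_right integrable_std_normal_moment)
  then show ?thesis
    by (simp add: poly_altdef sum_distrib_left sum_distrib_right mult_ac)
qed

lemma gauss_mean_add: "gauss_mean (p + q) = gauss_mean p + gauss_mean q"
  unfolding gauss_mean_def using integrable_poly_gauss[of p] integrable_poly_gauss[of q]
  by (simp add: distrib_right)

lemma gauss_mean_smult: "gauss_mean (smult c p) = c * gauss_mean p"
  unfolding gauss_mean_def by (simp add: mult.assoc)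

lemma gauss_mean_diff: "gauss_mean (p - q) = gauss_mean p - gauss_mean q"
  using gauss_mean_add[of "p - q" q] by simp

lemma gauss_mean_monom:
  "gauss_mean (monom 1 (2 * k)) = fact (2 * k) / (2 ^ k * fact k)"
  "gauss_mean (monom 1 (2 * k + 1)) = 0"
  unfolding gauss_mean_def poly_monom
  using integral_std_normal_moment_even[of k] integral_std_normal_moment_odd[of k]
  by (simp_all add: mult.commute)

lemma gauss_mean_monom_rec:
  "gauss_mean (monom 1 (Suc n)) = real n * gauss_mean (monom 1 (n - 1))"
proof (cases "even n")
  case True
  then obtain k where k: "n = 2 * k" by blast
  show ?thesis
  proof (cases k)
    case 0
    then show ?thesis using k gauss_mean_monom(2)[of 0] by simp
  next
    case (Suc j)
    have "n - 1 = 2 * j + 1" using k Suc by simp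
    then show ?thesis using k gauss_mean_monom(2)[of k] gauss_mean_monom(2)[of j] by simp
  qed
next
  case False
  then obtain k where k: "n = 2 * k + 1" by (blast elim: oddE)
  have "Suc n = 2 * Suc k" "n - 1 = 2 * k" using k by simp_all
  moreover have "(fact (2 * Suc k) :: real) = 2 * real (Suc k) * real n * fact (2 * k)"
    using k by (simp add: algebra_simps)
  then have "(fact (2 * Suc k) :: real) / (2 ^ Suc k * fact (Suc k)) =
      real n * (fact (2 * k) / (2 ^ k * fact k))"
    by (simp add: divide_simps del: of_nat_Suc)
  ultimately show ?thesis
    by (simp only: gauss_mean_monom(1))
qed

lemma gauss_mean_pderiv_aux:
  "gauss_mean (monom 1 (Suc n) * p) = gauss_mean (pderiv (monom 1 n * p))"
proof (induction p arbitrary: n)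
  case 0
  then show ?case by simp
next
  case (pCons a p)
  have s: "monom 1 k * pCons a p = smult a (monom 1 k) + monom 1 (Suc k) * p" for k
  proof -
    have "pCons a p = [:a:] + monom 1 1 * p" by (simp add: monom_altdef)
    then show ?thesis by (simp add: algebra_simps mult_monom flip: mult.assoc)
  qed
  have "gauss_mean (smult a (monom 1 (Suc n))) = gauss_mean (pderiv (smult a (monom 1 n)))"
  proof -
    have "pderiv (monom 1 n) = smult (real n) (monom 1 (n - 1) :: real poly)"
      by (simp add: pderiv_monom smult_monom)
    then show ?thesis
      by (simp only: pderiv_smult gauss_mean_smult gauss_mean_monom_rec)
  qed
  then show ?case
    unfolding s pderiv_add gauss_mean_add by (simp add: pCons.IH)
qed

lemma gauss_mean_pderiv: "gauss_mean ([:0, 1:] * p) = gauss_mean (pderiv p)"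
  using gauss_mean_pderiv_aux[of 0 p] by (simp add: monom_altdef)

lemma gauss_mean_Herm_Suc: "gauss_mean (Herm (Suc n) * q) = gauss_mean (Herm n * pderiv q)"
proof -
  have "Herm (Suc n) * q = [:0, 1:] * (Herm n * q) - pderiv (Herm n) * q"
    unfolding Herm_Suc by (simp only: left_diff_distrib mult.assoc)
  then have "gauss_mean (Herm (Suc n) * q) =
      gauss_mean (pderiv (Herm n * q)) - gauss_mean (pderiv (Herm n) * q)"
    by (simp only: gauss_mean_diff gauss_mean_pderiv)
  then show ?thesis
    by (simp add: pderiv_mult gauss_mean_add mult.commute)
qed

lemma gauss_mean_Herm: "gauss_mean (Herm m * Herm n) = (if m = n then fact n else 0)"
proof (induction m arbitrary: n)
  case 0
  show ?case
  proof (cases n)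
    case 0
    then show ?thesis using gauss_mean_monom(1)[of 0] by (simp add: monom_altdef one_pCons)
  next
    case (Suc k)
    then show ?thesis using gauss_mean_Herm_Suc[of k 1] by (simp add: gauss_mean_def)
  qed
next
  case (Suc m)
  show ?case
  proof (cases n)
    case 0
    then show ?thesis using gauss_mean_Herm_Suc[of m 1] by (simp add: gauss_mean_def)
  next
    case n: (Suc k)
    then show ?thesis
      by (simp add: gauss_mean_Herm_Suc pderiv_Herm_Suc gauss_mean_smult Suc.IH del: Herm.simps(2,3))
  qed
qed

theorem hermite_orthonormal: "gauss_inner (hermite k) (hermite l) = (if k = l then 1 else 0)"
proof -
  have [measurable]: "poly p \<in> borel_measurable borel" for p :: "real poly"
    by (intro borel_measurable_continuous_onI continuous_intros)
  have "gauss_inner (hermite k) (hermite l) =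
      (LINT x|lborel. hermite k x * hermite l x * std_normal_density x)"
    unfolding gauss_inner_def hermite_def by (rule integral_completion) measurable
  also have "\<dots> = (LINT x|lborel. (poly (Herm k * Herm l) x * std_normal_density x)
      / (sqrt (fact k) * sqrt (fact l)))"
    by (simp add: hermite_def)
  also have "\<dots> = gauss_mean (Herm k * Herm l) / (sqrt (fact k) * sqrt (fact l))"
    by (simp only: integral_divide_zero gauss_mean_def)
  finally show ?thesis by (simp add: gauss_mean_Herm)
qed


section \<open>Recovery region\<close>

definition tau :: "(real \<Rightarrow> real) \<Rightarrow> real \<Rightarrow> real \<Rightarrow> real" where
  "tau f \<beta> lam = (\<Sum>l. if l \<ge> 3
      then hermite_coeff f l * (lam - 1) ^ l / (sqrt (fact l) * \<beta> ^ (l - 1)) else 0)"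

definition psi_deriv :: "(real \<Rightarrow> real) \<Rightarrow> real \<Rightarrow> real \<Rightarrow> real" where
  "psi_deriv f \<gamma> s = (let a1 = hermite_coeff f 1 in
      1 / s\<^sup>2 - a1\<^sup>2 * \<gamma> / (1 + a1 * \<gamma> * s)\<^sup>2 - \<gamma> * ((gauss_norm f)\<^sup>2 - a1\<^sup>2))"

text \<open>For \<open>\<tau> = 0\<close> the value is the limit of the general expression as \<open>\<tau> \<longlongrightarrow> 0\<close>.\<close>

definition s_plus :: "(real \<Rightarrow> real) \<Rightarrow> real \<Rightarrow> real \<Rightarrow> real \<Rightarrow> real" where
  "s_plus f \<gamma> \<beta> lam = (let a1 = hermite_coeff f 1; \<tau> = tau f \<beta> lam in
      if \<tau> = 0 then - 1 / (a1 * (lam + \<gamma> - 1))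
      else (- a1 * (lam + \<gamma> - 1) - \<tau> + sqrt ((a1 * (lam + \<gamma> - 1) + \<tau>)\<^sup>2 - 4 * a1 * \<gamma> * \<tau>))
             / (2 * a1 * \<gamma> * \<tau>))"

definition recovery_region :: "(real \<Rightarrow> real) \<Rightarrow> real \<Rightarrow> real \<Rightarrow> real set" where
  "recovery_region f \<gamma> \<beta> = {lam. lam > 1 \<and>
      (hermite_coeff f 1 > 0 \<and> psi_deriv f \<gamma> (s_plus f \<gamma> \<beta> lam) > 0 \<or>
       hermite_coeff f 1 = 0 \<and> tau f \<beta> lam > sqrt \<gamma> * gauss_norm f)}"


section \<open>Regularity of kernel functions\<close>

definition twice_differentiable_at :: "(real \<Rightarrow> real) \<Rightarrow> real \<Rightarrow> bool" where
  "twice_differentiable_at f x \<longleftrightarrow>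
     (\<forall>\<^sub>F y in nhds x. f differentiable (at y)) \<and> deriv f differentiable (at x)"

definition regular_kernel :: "(real \<Rightarrow> real) \<Rightarrow> bool" where
  "regular_kernel f \<longleftrightarrow>
     continuous_on UNIV f \<and>
     finite {x. \<not> twice_differentiable_at f x} \<and>
     (\<exists>c>0. \<forall>x. \<bar>f x\<bar> \<le> c * exp (c * \<bar>x\<bar>) \<and>
        (f differentiable (at x) \<longrightarrow> \<bar>deriv f x\<bar> \<le> c * exp (c * \<bar>x\<bar>)) \<and>
        (twice_differentiable_at f x \<longrightarrow> \<bar>deriv (deriv f) x\<bar> \<le> c * exp (c * \<bar>x\<bar>)))"

end

theory Submission
  imports Defs
begin

text \<open>Write \<open>u = \<lambda> - 1\<close>, \<open>t = u / \<beta>\<close>, \<open>a = a\<^sub>1\<close> and \<open>n\<^sup>2 = \<parallel>f\<parallel>\<^sup>2 - a\<^sup>2\<close>.  By Bessel and Cauchy--Schwarz,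
  \<open>\<tau> \<le> \<kappa> n\<close> with \<open>\<kappa>\<^sup>2 = \<beta>\<^sup>2 (sinh t\<^sup>2 - t\<^sup>2)\<close>.  With \<open>y = - s\<^sub>+\<close> and \<open>X = a y / (1 - a \<gamma> y)\<close>, the
  quadratic equation for \<open>s\<^sub>+\<close> is the line \<open>u X + \<tau> y = 1\<close> and \<open>\<psi>'(s\<^sub>+) > 0\<close> is the disc
  \<open>\<gamma> (X\<^sup>2 + n\<^sup>2 y\<^sup>2) < 1\<close>.  The line meets the disc only if \<open>\<gamma> < u\<^sup>2 + \<kappa>\<^sup>2 = \<beta>\<^sup>2 sinh t\<^sup>2\<close>, which gives
  the critical value \<open>\<lambda>\<^sub>* = 1 + \<beta> sqrt (arsinh (\<gamma> / \<beta>\<^sup>2))\<close>.  At \<open>\<lambda>\<^sub>*\<close> the kernel in the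
  equality case with \<open>n = \<kappa>\<close> has \<open>y = 1 / \<gamma>\<close> and \<open>a = (\<lambda>\<^sub>* - 1) / \<lambda>\<^sub>*\<close>; for larger \<open>\<lambda>\<close> its \<open>y\<close>
  decreases, so it stays inside the disc.\<close>

section \<open>The Gaussian inner product and square-integrable functions\<close>

text \<open>This is \<open>L2_odd\<close> without the oddness: the even Hermite polynomials and the
  exponentials \<open>hermite_gen\<close> have to be covered as well.\<close>

definition gauss_L2 :: "(real \<Rightarrow> real) \<Rightarrow> bool" where
  "gauss_L2 f \<longleftrightarrow> f \<in> borel_measurable lebesgue \<and>
     integrable lebesgue (\<lambda>x. (f x)\<^sup>2 * std_normal_density x)"

lemma std_normal_density_measurable_lebesgue [measurable]:
  "std_normal_density \<in> borel_measurable lebesgue"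
  by (rule measurable_completion) simp

text \<open>The weighted sum of squares dominates the product. Additivity of
  \<open>gauss_inner\<close> rests on this, since the Bochner integral need not be additive on
  non-integrable functions.\<close>

lemma gauss_L2_integrable_mult:
  assumes "gauss_L2 f" "gauss_L2 g"
  shows "integrable lebesgue (\<lambda>x. f x * g x * std_normal_density x)"
proof (rule Bochner_Integration.integrable_bound)
  have [measurable]: "f \<in> borel_measurable lebesgue" "g \<in> borel_measurable lebesgue"
    using assms by (simp_all add: gauss_L2_def)
  show "(\<lambda>x. f x * g x * std_normal_density x) \<in> borel_measurable lebesgue"
    by measurable
  show "integrable lebesgue
      (\<lambda>x. (f x)\<^sup>2 * std_normal_density x + (g x)\<^sup>2 * std_normal_density x)"
    using assms by (simp add: gauss_L2_def)
  have "\<bar>f x * g x\<bar> \<le> (f x)\<^sup>2 + (g x)\<^sup>2" for x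
  proof -
    have "2 * (\<bar>f x\<bar> * \<bar>g x\<bar>) \<le> (f x)\<^sup>2 + (g x)\<^sup>2"
      using sum_squares_bound[of "\<bar>f x\<bar>" "\<bar>g x\<bar>"] by simp
    moreover have "0 \<le> \<bar>f x\<bar> * \<bar>g x\<bar>" by simp
    ultimately show ?thesis unfolding abs_mult by linarith
  qed
  then have "\<bar>f x * g x\<bar> * std_normal_density x \<le> ((f x)\<^sup>2 + (g x)\<^sup>2) * std_normal_density x" for x
    by (intro mult_right_mono) simp_all
  then show "AE x in lebesgue. norm (f x * g x * std_normal_density x)
      \<le> norm ((f x)\<^sup>2 * std_normal_density x + (g x)\<^sup>2 * std_normal_density x)"
    by (simp add: abs_mult distrib_right)
qed

lemma gauss_L2_cmult:
  assumes "gauss_L2 f"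
  shows "gauss_L2 (\<lambda>x. c * f x)"
proof -
  have [measurable]: "f \<in> borel_measurable lebesgue"
    using assms by (simp add: gauss_L2_def)
  show ?thesis
    using assms by (simp add: gauss_L2_def power_mult_distrib mult.assoc)
qed

lemma gauss_L2_add:
  assumes "gauss_L2 f" "gauss_L2 g"
  shows "gauss_L2 (\<lambda>x. f x + g x)"
proof -
  have [measurable]: "f \<in> borel_measurable lebesgue" "g \<in> borel_measurable lebesgue"
    using assms by (simp_all add: gauss_L2_def)
  have "integrable lebesgue (\<lambda>x. (f x)\<^sup>2 * std_normal_density x
      + 2 * (f x * g x * std_normal_density x) + (g x)\<^sup>2 * std_normal_density x)"
    using assms gauss_L2_integrable_mult[OF assms] by (simp add: gauss_L2_def)
  then show ?thesis
    by (simp add: gauss_L2_def power2_sum algebra_simps)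
qed

lemma gauss_L2_sum:
  assumes "finite A" "\<And>k. k \<in> A \<Longrightarrow> gauss_L2 (f k)"
  shows "gauss_L2 (\<lambda>x. \<Sum>k\<in>A. f k x)"
  using assms by induction (simp_all add: gauss_L2_add gauss_L2_def[of "\<lambda>_. 0"])

lemma gauss_inner_commute: "gauss_inner f g = gauss_inner g f"
  by (simp add: gauss_inner_def mult.commute)

lemma gauss_inner_self_nonneg: "gauss_inner f f \<ge> 0"
  unfolding gauss_inner_def by (intro Bochner_Integration.integral_nonneg) simp

lemma gauss_inner_cmult_left: "gauss_inner (\<lambda>x. c * f x) g = c * gauss_inner f g"
  by (simp add: gauss_inner_def mult.assoc)

lemma gauss_inner_add_left:
  assumes "gauss_L2 f" "gauss_L2 g" "gauss_L2 h"
  shows "gauss_inner (\<lambda>x. f x + g x) h = gauss_inner f h + gauss_inner g h"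
  using gauss_L2_integrable_mult[OF assms(1,3)] gauss_L2_integrable_mult[OF assms(2,3)]
  by (simp add: gauss_inner_def distrib_right)

lemma gauss_inner_sum_left:
  assumes "finite A" "\<And>k. k \<in> A \<Longrightarrow> gauss_L2 (f k)" "gauss_L2 g"
  shows "gauss_inner (\<lambda>x. \<Sum>k\<in>A. f k x) g = (\<Sum>k\<in>A. gauss_inner (f k) g)"
  using assms
proof induction
  case empty
  then show ?case by (simp add: gauss_inner_def)
next
  case (insert k A)
  then show ?case by (simp add: gauss_inner_add_left gauss_L2_sum)
qed

lemma gauss_L2_poly: "gauss_L2 (poly p)"
proof -
  have m: "poly q \<in> borel_measurable borel" for q :: "real poly"
    by (intro borel_measurable_continuous_onI continuous_intros)
  have "integrable lborel (\<lambda>x. (poly p x)\<^sup>2 * std_normal_density x)"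
    using integrable_poly_gauss[of "p\<^sup>2"] by simp
  moreover have "(\<lambda>x. (poly p x)\<^sup>2 * std_normal_density x) \<in> borel_measurable lborel"
    using m[of p] by measurable
  moreover have "poly p \<in> borel_measurable lebesgue"
    by (rule measurable_completion) (simp add: m)
  ultimately show ?thesis
    by (simp add: gauss_L2_def integrable_completion)
qed

lemma gauss_L2_hermite: "gauss_L2 (hermite k)"
proof -
  have "hermite k = poly (smult (1 / sqrt (fact k)) (Herm k))"
    by (simp add: fun_eq_iff hermite_def)
  then show ?thesis by (simp only: gauss_L2_poly)
qed

section \<open>Bessel's inequality\<close>

text \<open>The residual \<open>d\<close> of \<open>f\<close> after projection onto the chosen
  Hermite polynomials is orthogonal to the projection \<open>s\<close>. Hence its squared norm,
  which is nonnegative, is that of \<open>f\<close> minus the sum of squared coefficients.\<close>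

lemma bessel:
  assumes f: "gauss_L2 f" and A: "finite A"
  shows "(\<Sum>k\<in>A. (hermite_coeff f k)\<^sup>2) \<le> gauss_inner f f"
proof -
  define s where "s = (\<lambda>x. \<Sum>k\<in>A. hermite_coeff f k * hermite k x)"
  \<comment> \<open>The factor \<open>- 1\<close> makes the rules for sums and scalar multiples
    apply.\<close>
  define d where "d = (\<lambda>x. f x + (- 1) * s x)"
  note L2 = gauss_L2_cmult gauss_L2_add gauss_L2_hermite f
  have s: "gauss_L2 s"
    unfolding s_def by (intro gauss_L2_sum A L2)
  have d: "gauss_L2 d"
    unfolding d_def by (intro L2 s)
  have s_left: "gauss_inner s g = (\<Sum>k\<in>A. hermite_coeff f k * gauss_inner (hermite k) g)"
    if "gauss_L2 g" for g
    unfolding s_def by (subst gauss_inner_sum_left) (simp_all add: A L2 that gauss_inner_cmult_left)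
  have sf: "gauss_inner s f = (\<Sum>k\<in>A. (hermite_coeff f k)\<^sup>2)"
    using s_left[OF f]
    by (simp add: hermite_coeff_def power2_eq_square gauss_inner_commute[of "hermite _" f])
  have sh: "gauss_inner s (hermite k) = hermite_coeff f k" if "k \<in> A" for k
    using that A by (simp add: s_left L2 hermite_orthonormal if_distrib cong: if_cong)
  have d_left: "gauss_inner d g = gauss_inner f g - gauss_inner s g" if "gauss_L2 g" for g
    using gauss_inner_add_left[OF f gauss_L2_cmult[OF s] that, of "- 1"]
    unfolding gauss_inner_cmult_left by (simp add: d_def)
  have "gauss_inner (hermite k) d = 0" if "k \<in> A" for k
    using that d_left[OF gauss_L2_hermite, of k]
    by (simp add: sh gauss_inner_commute[of _ d]) (simp add: hermite_coeff_def)
  then have "gauss_inner s d = 0"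
    by (simp add: s_left d)
  then have "gauss_inner d d = gauss_inner d f"
    by (simp add: d_left[OF d] gauss_inner_commute[of f])
  also have "\<dots> = gauss_inner f f - gauss_inner s f"
    by (rule d_left[OF f])
  finally show ?thesis
    using gauss_inner_self_nonneg[of d] by (simp add: sf)
qed

section \<open>Parity and the Cauchy-Schwarz bound on \<open>tau\<close>\<close>

lemma poly_Herm_minus: "poly (Herm k) (- x) = (- 1) ^ k * poly (Herm k) x"
  by (induction k rule: Herm.induct) (simp_all add: algebra_simps)

text \<open>Reflection preserves Lebesgue measure, so the integral equals its own negative.\<close>

lemma integral_lebesgue_odd:
  fixes f :: "real \<Rightarrow> real"
  assumes "f \<in> borel_measurable lebesgue" "\<And>x. f (- x) = - f x"
  shows "(LINT x|lebesgue. f x) = 0"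
proof -
  have "lebesgue = distr lebesgue lebesgue (uminus :: real \<Rightarrow> real)"
    using lebesgue_real_scale[of "- 1"] by (simp add: density_1 flip: one_ennreal_def)
  then have "(LINT x|lebesgue. f x) = (LINT x|distr lebesgue lebesgue uminus. f x)"
    by simp
  also have "\<dots> = (LINT x|lebesgue. f (- x))"
  proof (rule integral_distr[OF _ assms(1)])
    have "(uminus :: real \<Rightarrow> real) = (*\<^sub>R) (- 1)"
      by (simp add: fun_eq_iff)
    then show "(uminus :: real \<Rightarrow> real) \<in> lebesgue \<rightarrow>\<^sub>M lebesgue"
      using lebesgue_measurable_scaling[of "- 1 :: real"] by metis
  qed
  finally show ?thesis
    by (simp add: assms(2))
qed

lemma hermite_coeff_even_eq_0:
  assumes "f \<in> L2_odd" "even k"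
  shows "hermite_coeff f k = 0"
  unfolding hermite_coeff_def gauss_inner_def
proof (rule integral_lebesgue_odd)
  have [measurable]: "f \<in> borel_measurable lebesgue" "hermite k \<in> borel_measurable lebesgue"
    using assms gauss_L2_hermite[of k] by (simp_all add: L2_odd_def gauss_L2_def)
  show "(\<lambda>x. f x * hermite k x * std_normal_density x) \<in> borel_measurable lebesgue"
    by measurable
qed (use assms in \<open>simp add: L2_odd_def hermite_def poly_Herm_minus std_normal_density_def\<close>)

text \<open>This series occurs twice: at \<open>t^2\<close> as the squared length of the weights in
  \<open>tau\<close>, and as the value of \<open>tau\<close> at the kernel itself.\<close>

lemma sinh_minus_id_sums:
  fixes x :: real
  shows "(\<lambda>n. if odd n \<and> n \<ge> 3 then x ^ n / fact n else 0) sums (sinh x - x)"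
proof -
  have "(\<lambda>n. if n = 1 then x else 0) sums x"
    using sums_single[of 1 "\<lambda>_. x"] by simp
  from sums_diff[OF sinh_converges[of x] this] show ?thesis
  proof (rule sums_cong[THEN iffD1, rotated])
    fix n :: nat
    have "n = 0 \<or> n = 1 \<or> n = 2 \<or> n \<ge> 3" by linarith
    then show "(if even n then 0 else x ^ n /\<^sub>R fact n) - (if n = 1 then x else 0) =
        (if odd n \<and> n \<ge> 3 then x ^ n / fact n else 0)"
      by (auto simp: divide_inverse mult.commute)
  qed
qed

text \<open>Cauchy-Schwarz for the series \<open>\<beta> * (\<Sum>l. c l * d l)\<close>: Bessel
  bounds the squares of the coefficients \<open>c\<close>, and the squares of the weights
  \<open>d\<close> sum to \<open>sinh (t^2) - t^2\<close>.\<close>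

lemma tau_le:
  fixes \<beta> lam :: real
  assumes f: "f \<in> L2_odd" and "\<beta> > 0"
  defines "t \<equiv> (lam - 1) / \<beta>"
  shows "tau f \<beta> lam \<le>
    \<beta> * (sqrt (gauss_inner f f - (hermite_coeff f 1)\<^sup>2) * sqrt (sinh (t\<^sup>2) - t\<^sup>2))"
proof -
  define c where "c = (\<lambda>l::nat. if l \<ge> 3 then hermite_coeff f l else 0)"
  \<comment> \<open>Since the even coefficients of \<open>f\<close> vanish, the weights may be
    restricted to odd indices; this is what turns the exponential series into sinh.\<close>
  define d where "d = (\<lambda>l::nat. if odd l \<and> l \<ge> 3 then t ^ l / sqrt (fact l) else 0)"
  let ?B = "sqrt (gauss_inner f f - (hermite_coeff f 1)\<^sup>2) * sqrt (sinh (t\<^sup>2) - t\<^sup>2)"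
  have L2: "gauss_L2 f"
    using f by (simp add: L2_odd_def gauss_L2_def)
  have c2: "(\<Sum>l<N. (c l)\<^sup>2) \<le> gauss_inner f f - (hermite_coeff f 1)\<^sup>2" for N
  proof -
    have "(\<Sum>l<N. (c l)\<^sup>2) = (\<Sum>l\<in>{3..<N}. (hermite_coeff f l)\<^sup>2)"
      by (rule sum.mono_neutral_cong_right) (auto simp: c_def)
    \<comment> \<open>Index 1 joins the sum, so that \<open>a_1^2\<close> can be subtracted from the
      squared norm.\<close>
    moreover have "(hermite_coeff f 1)\<^sup>2 + (\<Sum>l\<in>{3..<N}. (hermite_coeff f l)\<^sup>2) \<le> gauss_inner f f"
      using bessel[OF L2, of "insert 1 {3..<N}"] by simp
    ultimately show ?thesis by simp
  qed
  have "(\<lambda>l. (d l)\<^sup>2) sums (sinh (t\<^sup>2) - t\<^sup>2)"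
  proof (rule sums_cong[THEN iffD1, OF _ sinh_minus_id_sums])
    show "(if odd n \<and> n \<ge> 3 then (t\<^sup>2) ^ n / fact n else 0) = (d n)\<^sup>2" for n
      by (simp add: d_def power_divide mult.commute flip: power_mult)
  qed
  then have d2: "(\<Sum>l<N. (d l)\<^sup>2) \<le> sinh (t\<^sup>2) - t\<^sup>2" for N
    by (metis sum_le_suminf finite_lessThan sums_iff zero_le_power2)
  have abs_le: "(\<Sum>l<N. \<bar>c l * d l\<bar>) \<le> ?B" for N
  proof -
    have "(\<Sum>l<N. \<bar>c l * d l\<bar>) \<le> L2_set c {..<N} * L2_set d {..<N}"
      unfolding abs_mult by (rule L2_set_mult_ineq)
    also have "\<dots> \<le> ?B"
      unfolding L2_set_def
      by (intro mult_mono real_sqrt_le_mono c2 d2) (use c2[of 0] in \<open>simp_all add: sum_nonneg\<close>)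
    finally show ?thesis .
  qed
  \<comment> \<open>Absolute convergence ensures that the \<open>suminf\<close> in
    \<open>tau\<close> is a genuine limit of partial sums.\<close>
  have sm: "summable (\<lambda>l. \<bar>c l * d l\<bar>)"
    by (rule summableI_nonneg_bounded) (use abs_le in auto)
  then have sm': "summable (\<lambda>l. c l * d l)"
    by (rule summable_rabs_cancel)
  have "(\<Sum>l. c l * d l) \<le> ?B"
  proof (rule suminf_le_const[OF sm'])
    show "(\<Sum>l<N. c l * d l) \<le> ?B" for N
      by (rule order_trans[OF sum_mono abs_le]) simp
  qed
  moreover have "tau f \<beta> lam = \<beta> * (\<Sum>l. c l * d l)"
    unfolding tau_def suminf_mult[OF sm', symmetric]
  proof (rule arg_cong[where f = suminf], rule ext)
    fix l :: nat
    have "\<beta> ^ l = \<beta> * \<beta> ^ (l - 1)" if "l \<ge> 3"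
      using that by (cases l) simp_all
    then show "(if 3 \<le> l then hermite_coeff f l * (lam - 1) ^ l / (sqrt (fact l) * \<beta> ^ (l - 1)) else 0)
        = \<beta> * (c l * d l)"
      using \<open>\<beta> > 0\<close> hermite_coeff_even_eq_0[OF f, of l]
      by (simp add: c_def d_def t_def power_divide)
  qed
  ultimately show ?thesis
    using \<open>\<beta> > 0\<close> by simp
qed

section \<open>The generating function of the Hermite polynomials\<close>

text \<open>In the shifted three-term recurrence, Gaussian integration by parts turns the factor
  \<open>x\<close> into a derivative, which cancels the last term. What remains is \<open>t\<close>
  times the previous value.\<close>

lemma gauss_mean_Herm_shift: "gauss_mean (pcompose (Herm k) [:t, 1:]) = t ^ k"
proof (induction k rule: Herm.induct)
  case 1
  show ?case using gauss_mean_Herm[of 0 0] by (simp add: pcompose_1)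
next
  case 2
  \<comment> \<open>Products with \<open>Herm 0 = 1\<close> bring both means into the form of
    \<open>gauss_mean_Herm\<close>.\<close>
  have "[:t, 1:] = smult t (Herm 0 * Herm 0) + Herm 0 * Herm 1"
    by (simp add: one_pCons)
  then show ?case
    unfolding pcompose_pCons Herm.simps(2)
    by (simp add: gauss_mean_add gauss_mean_smult gauss_mean_Herm del: Herm.simps)
next
  case (3 n)
  let ?p = "\<lambda>k. pcompose (Herm k) [:t, 1:]"
  have "?p (Suc (Suc n)) = smult t (?p (Suc n)) + [:0, 1:] * ?p (Suc n) - smult (real (Suc n)) (?p n)"
  proof -
    have "pcompose [:0, 1:] [:t, 1:] = [:t:] + [:0, 1:]"
      by (simp add: pcompose_pCons)
    then show ?thesis
      unfolding Herm.simps(3) pcompose_diff pcompose_mult pcompose_smult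
      by (simp add: algebra_simps)
  qed
  moreover have "pderiv (?p (Suc n)) = smult (real (Suc n)) (?p n)"
    by (simp add: pderiv_pcompose pderiv_Herm_Suc pcompose_smult pderiv_pCons del: Herm.simps)
  ultimately show ?case
    using 3 gauss_mean_pderiv[of "?p (Suc n)"]
    by (simp add: gauss_mean_add gauss_mean_diff gauss_mean_smult del: Herm.simps)
qed

text \<open>The generating function of the monic Hermite polynomials: the sum of
  \<open>t^k / k!\<close> times \<open>Herm k\<close> at \<open>x\<close>.\<close>

definition hermite_gen :: "real \<Rightarrow> real \<Rightarrow> real" where
  "hermite_gen t x = exp (t * x - t\<^sup>2 / 2)"

text \<open>Reduces squares and inner products to the integral of a single
  \<open>hermite_gen\<close>.\<close>

lemma hermite_gen_mult: "hermite_gen s x * hermite_gen t x = exp (s * t) * hermite_gen (s + t) x"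
  by (simp add: hermite_gen_def field_simps power2_eq_square flip: exp_add)

text \<open>The weight \<open>hermite_gen t x * std_normal_density x\<close> is the normal density shifted by \<open>t\<close>.\<close>

lemma has_integral_hermite_gen_poly:
  "has_bochner_integral lebesgue (\<lambda>x. hermite_gen t x * poly p x * std_normal_density x)
     (gauss_mean (pcompose p [:t, 1:]))"
proof -
  let ?F = "\<lambda>x. hermite_gen t x * poly p x * std_normal_density x"
  have "hermite_gen t (t + x) * std_normal_density (t + x) = std_normal_density x" for x
  proof -
    have "t * (t + x) - t\<^sup>2 / 2 + - (t + x)\<^sup>2 / 2 = - x\<^sup>2 / 2"
      by (simp add: field_simps power2_eq_square)
    then show ?thesis
      by (simp add: hermite_gen_def std_normal_density_def flip: exp_add)
  qed
  then have "?F (t + 1 * x) = poly (pcompose p [:t, 1:]) x * std_normal_density x" for x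
    by (simp add: poly_pcompose mult_ac)
  moreover have "has_bochner_integral lborel (\<lambda>x. poly (pcompose p [:t, 1:]) x * std_normal_density x)
     (gauss_mean (pcompose p [:t, 1:]))"
    by (simp add: has_bochner_integral_iff integrable_poly_gauss gauss_mean_def)
  ultimately have *: "has_bochner_integral lborel ?F (gauss_mean (pcompose p [:t, 1:]))"
    by (subst lborel_has_bochner_integral_real_affine_iff[where c = 1 and t = t]) simp_all
  then have "?F \<in> borel_measurable lborel"
    by (auto simp: has_bochner_integral_iff)
  with * show ?thesis
    by (simp add: has_bochner_integral_iff integrable_completion integral_completion)
qed

lemma gauss_L2_hermite_gen: "gauss_L2 (hermite_gen t)"
proof -
  have "hermite_gen t \<in> borel_measurable borel"
    unfolding hermite_gen_def by measurable
  then have "hermite_gen t \<in> borel_measurable lebesgue"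
    by (intro measurable_completion) simp
  moreover have "integrable lebesgue (\<lambda>x. exp (t * t) * (hermite_gen (t + t) x * std_normal_density x))"
    using has_integral_hermite_gen_poly[of "t + t" 1] by (simp add: has_bochner_integral_iff)
  ultimately show ?thesis
    by (simp add: gauss_L2_def power2_eq_square hermite_gen_mult mult.assoc)
qed

lemma hermite_coeff_hermite_gen: "hermite_coeff (hermite_gen t) k = t ^ k / sqrt (fact k)"
proof -
  have "(LINT x|lebesgue. hermite_gen t x * poly (Herm k) x * std_normal_density x) = t ^ k"
    using has_integral_hermite_gen_poly[of t "Herm k"]
    by (simp add: has_bochner_integral_iff gauss_mean_Herm_shift)
  then show ?thesis
    by (simp add: hermite_coeff_def gauss_inner_def hermite_def)
qed

lemma gauss_inner_hermite_gen: "gauss_inner (hermite_gen s) (hermite_gen t) = exp (s * t)"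
proof -
  have "gauss_inner (hermite_gen s) (hermite_gen t)
      = exp (s * t) * (LINT x|lebesgue. hermite_gen (s + t) x * poly 1 x * std_normal_density x)"
    by (simp add: gauss_inner_def hermite_gen_mult mult.assoc)
  also have "(LINT x|lebesgue. hermite_gen (s + t) x * poly 1 x * std_normal_density x) = 1"
    using has_integral_hermite_gen_poly[of "s + t" 1] gauss_mean_Herm[of 0 0]
    by (simp add: has_bochner_integral_iff pcompose_1)
  finally show ?thesis by simp
qed

section \<open>The kernel: coefficients, norm, \<open>tau\<close> and regularity\<close>

text \<open>One family contains both the optimal kernel (\<kappa> = \<beta>) and \<open>g\<close>
  (\<alpha> = 0, \<kappa> = 1). Subtracting \<open>t * x\<close> removes the degree-one Hermite
  component of the sinh term, so that \<alpha> is the coefficient of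
  \<open>hermite 1\<close>.\<close>

definition sinh_kernel :: "real \<Rightarrow> real \<Rightarrow> real \<Rightarrow> real \<Rightarrow> real" where
  "sinh_kernel \<alpha> \<kappa> t x = \<alpha> * x + \<kappa> * (exp (- t\<^sup>2 / 2) * sinh (t * x) - t * x)"

lemma hermite_1: "hermite 1 x = x"
  by (simp add: hermite_def)

text \<open>Splitting sinh into exponentials gives generating functions at \<open>t\<close> and
  \<open>- t\<close>, whose coefficients and inner products are explicit.\<close>

lemma sinh_kernel_altdef:
  "sinh_kernel \<alpha> \<kappa> t = (\<lambda>x. (\<alpha> - \<kappa> * t) * hermite 1 x
     + (\<kappa> / 2 * hermite_gen t x + (- \<kappa> / 2) * hermite_gen (- t) x))"
proof
  fix x
  have eq: "exp (- t\<^sup>2 / 2) * sinh (t * x) = (hermite_gen t x - hermite_gen (- t) x) / 2"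
  proof -
    have "exp (- t\<^sup>2 / 2) * sinh (t * x)
        = (exp (- t\<^sup>2 / 2) * exp (t * x) - exp (- t\<^sup>2 / 2) * exp (- (t * x))) / 2"
      by (simp add: sinh_field_def right_diff_distrib)
    then show ?thesis
      by (simp add: hermite_gen_def flip: exp_add)
  qed
  show "sinh_kernel \<alpha> \<kappa> t x = (\<alpha> - \<kappa> * t) * hermite 1 x
     + (\<kappa> / 2 * hermite_gen t x + (- \<kappa> / 2) * hermite_gen (- t) x)"
    unfolding hermite_1 sinh_kernel_def eq by (simp add: algebra_simps diff_divide_distrib)
qed

lemma gauss_L2_sinh_kernel: "gauss_L2 (sinh_kernel \<alpha> \<kappa> t)"
  unfolding sinh_kernel_altdef
  by (intro gauss_L2_add gauss_L2_cmult gauss_L2_hermite gauss_L2_hermite_gen)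

lemma sinh_kernel_L2_odd: "sinh_kernel \<alpha> \<kappa> t \<in> L2_odd"
  using gauss_L2_sinh_kernel[of \<alpha> \<kappa> t]
  by (simp add: L2_odd_def gauss_L2_def) (simp add: sinh_kernel_def algebra_simps)

lemma gauss_inner_sinh_kernel_left:
  assumes "gauss_L2 f"
  shows "gauss_inner (sinh_kernel \<alpha> \<kappa> t) f = (\<alpha> - \<kappa> * t) * gauss_inner (hermite 1) f
     + (\<kappa> / 2 * gauss_inner (hermite_gen t) f + (- \<kappa> / 2) * gauss_inner (hermite_gen (- t)) f)"
  unfolding sinh_kernel_altdef
  by (simp only: gauss_inner_add_left gauss_inner_cmult_left gauss_L2_add gauss_L2_cmult
      gauss_L2_hermite gauss_L2_hermite_gen assms)

lemma hermite_coeff_sinh_kernel: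
  "hermite_coeff (sinh_kernel \<alpha> \<kappa> t) k =
     (if k = 1 then \<alpha> else if odd k then \<kappa> * t ^ k / sqrt (fact k) else 0)"
proof -
  have "hermite_coeff (sinh_kernel \<alpha> \<kappa> t) k = (\<alpha> - \<kappa> * t) * (if k = 1 then 1 else 0)
     + (\<kappa> / 2 * (t ^ k / sqrt (fact k)) + (- \<kappa> / 2) * ((- t) ^ k / sqrt (fact k)))"
    using gauss_inner_sinh_kernel_left[OF gauss_L2_hermite, of \<alpha> \<kappa> t k]
    unfolding hermite_coeff_def[symmetric] hermite_coeff_hermite_gen
    by (simp add: hermite_coeff_def hermite_orthonormal)
  then show ?thesis by (auto simp: field_simps)
qed

text \<open>Bilinearity gives the exact norm, where Bessel would bound it only from below; the disc
  condition needs the exact value.\<close>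

lemma gauss_inner_sinh_kernel:
  "gauss_inner (sinh_kernel \<alpha> \<kappa> t) (sinh_kernel \<alpha> \<kappa> t) = \<alpha>\<^sup>2 + \<kappa>\<^sup>2 * (sinh (t\<^sup>2) - t\<^sup>2)"
proof -
  let ?F = "sinh_kernel \<alpha> \<kappa> t"
  have inner_1: "gauss_inner (hermite 1) ?F = \<alpha>"
    using hermite_coeff_sinh_kernel[of \<alpha> \<kappa> t 1]
    by (subst gauss_inner_commute) (simp add: hermite_coeff_def)
  have coeff_1: "gauss_inner (hermite 1) (hermite_gen s) = s" for s
    using hermite_coeff_hermite_gen[of s 1]
    by (subst gauss_inner_commute) (simp add: hermite_coeff_def)
  have gen: "gauss_inner (hermite_gen s) ?F
      = (\<alpha> - \<kappa> * t) * s + \<kappa> / 2 * (exp (t * s) - exp (- (t * s)))" for s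
    using gauss_inner_sinh_kernel_left[OF gauss_L2_hermite_gen, of \<alpha> \<kappa> t s]
    unfolding coeff_1
    by (simp add: gauss_inner_commute[of _ ?F] gauss_inner_hermite_gen right_diff_distrib)
  show ?thesis
    unfolding gauss_inner_sinh_kernel_left[OF gauss_L2_sinh_kernel] inner_1 gen
    by (simp add: sinh_field_def power2_eq_square field_simps)
qed

text \<open>The kernel's own \<open>t\<close> stays fixed while \<open>lam\<close> varies;
  \<open>r = t^2\<close> at \<open>lam = 1 + \<beta> * t\<close>.\<close>

lemma tau_sinh_kernel:
  fixes \<beta> lam t :: real
  assumes "\<beta> > 0"
  defines "r \<equiv> (lam - 1) / \<beta> * t"
  shows "tau (sinh_kernel \<alpha> \<kappa> t) \<beta> lam = \<beta> * \<kappa> * (sinh r - r)"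
proof -
  have "(\<lambda>l. \<beta> * \<kappa> * (if odd l \<and> l \<ge> 3 then r ^ l / fact l else 0)) sums (\<beta> * \<kappa> * (sinh r - r))"
    by (intro sums_mult sinh_minus_id_sums)
  moreover have "(if 3 \<le> l then hermite_coeff (sinh_kernel \<alpha> \<kappa> t) l * (lam - 1) ^ l
        / (sqrt (fact l) * \<beta> ^ (l - 1)) else 0)
      = \<beta> * \<kappa> * (if odd l \<and> l \<ge> 3 then r ^ l / fact l else 0)" for l
  proof -
    have "\<beta> ^ l = \<beta> * \<beta> ^ (l - 1)" if "l \<ge> 3"
      using that by (cases l) simp_all
    then show ?thesis
      using \<open>\<beta> > 0\<close>
      by (auto simp: hermite_coeff_sinh_kernel r_def power_divide power_mult_distrib mult_ac)
  qed
  ultimately show ?thesis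
    unfolding tau_def by (simp add: sums_iff)
qed

lemma regular_kernel_sinh_kernel:
  fixes t :: real
  assumes "t \<ge> 0"
  shows "regular_kernel (sinh_kernel \<alpha> \<kappa> t)"
proof -
  define e where "e = \<kappa> * exp (- t\<^sup>2 / 2)"
  define f where "f = sinh_kernel \<alpha> \<kappa> t"
  define f' where "f' = (\<lambda>x. \<alpha> - \<kappa> * t + e * t * cosh (t * x))"
  define f'' where "f'' = (\<lambda>x. e * t\<^sup>2 * sinh (t * x))"
  \<comment> \<open>One constant serves as factor and as rate: it dominates all coefficients of
    \<open>f\<close>, \<open>f'\<close> and \<open>f''\<close>, the growth rate \<open>t\<close>,
    and 1, which gives \<open>\<bar>x\<bar> \<le> c * \<bar>x\<bar>\<close>.\<close>
  define c where "c = 1 + t + \<bar>\<alpha> - \<kappa> * t\<bar> + \<bar>e\<bar> + \<bar>e\<bar> * t + \<bar>e\<bar> * t\<^sup>2"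
  have f_eq: "f = (\<lambda>x. (\<alpha> - \<kappa> * t) * x + e * sinh (t * x))"
    by (simp add: f_def sinh_kernel_def e_def fun_eq_iff algebra_simps)
  have D: "(f has_real_derivative f' x) (at x)" for x
    unfolding f_eq f'_def by (auto intro!: derivative_eq_intros)
  have D': "(f' has_real_derivative f'' x) (at x)" for x
    unfolding f'_def f''_def by (auto intro!: derivative_eq_intros simp: power2_eq_square)
  have f': "deriv f = f'" and f'': "deriv f' = f''"
    using D D' by (auto intro!: DERIV_imp_deriv)
  have twice: "twice_differentiable_at f x" for x
    using D D' unfolding twice_differentiable_at_def f'
    by (auto simp: real_differentiable_def intro!: always_eventually)
  have t: "t \<le> c" "1 \<le> c"
    using assms by (simp_all add: c_def)
  have bounds: "1 \<le> exp (c * \<bar>x\<bar>)" "\<bar>x\<bar> \<le> exp (c * \<bar>x\<bar>)"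
    "\<bar>sinh (t * x)\<bar> \<le> exp (c * \<bar>x\<bar>)" "\<bar>cosh (t * x)\<bar> \<le> exp (c * \<bar>x\<bar>)" for x
  proof -
    have x: "\<bar>x\<bar> \<le> c * \<bar>x\<bar>" "t * \<bar>x\<bar> \<le> c * \<bar>x\<bar>"
      using t mult_right_mono[of 1 c "\<bar>x\<bar>"] by (simp_all add: mult_right_mono)
    then show "1 \<le> exp (c * \<bar>x\<bar>)" "\<bar>x\<bar> \<le> exp (c * \<bar>x\<bar>)"
      using exp_ge_add_one_self[of "c * \<bar>x\<bar>"] by linarith+
    have cosh: "\<bar>cosh (t * x)\<bar> \<le> exp (t * \<bar>x\<bar>)"
    proof -
      have "cosh (t * x) = cosh (t * \<bar>x\<bar>)"
        by (cases "x \<ge> 0") simp_all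
      also have "\<dots> \<le> exp (t * \<bar>x\<bar>)"
      proof -
        have "sinh (t * \<bar>x\<bar>) \<ge> 0" using assms by simp
        then show ?thesis using cosh_plus_sinh[of "t * \<bar>x\<bar>"] by linarith
      qed
      finally show ?thesis by simp
    qed
    also have "\<dots> \<le> exp (c * \<bar>x\<bar>)" using x by simp
    finally show "\<bar>cosh (t * x)\<bar> \<le> exp (c * \<bar>x\<bar>)" .
    moreover have "\<bar>sinh (t * x)\<bar> \<le> \<bar>cosh (t * x)\<bar>"
      using sinh_le_cosh_real[of "\<bar>t * x\<bar>"] by simp
    ultimately show "\<bar>sinh (t * x)\<bar> \<le> exp (c * \<bar>x\<bar>)" by linarith
  qed
  have lin: "\<bar>p * u + q * v\<bar> \<le> c * exp (c * \<bar>x\<bar>)"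
    if "\<bar>u\<bar> \<le> exp (c * \<bar>x\<bar>)" "\<bar>v\<bar> \<le> exp (c * \<bar>x\<bar>)" "\<bar>p\<bar> + \<bar>q\<bar> \<le> c" for p q u v x
  proof -
    have "\<bar>p * u + q * v\<bar> \<le> \<bar>p\<bar> * \<bar>u\<bar> + \<bar>q\<bar> * \<bar>v\<bar>"
      using abs_triangle_ineq[of "p * u" "q * v"] by (simp add: abs_mult)
    also have "\<dots> \<le> \<bar>p\<bar> * exp (c * \<bar>x\<bar>) + \<bar>q\<bar> * exp (c * \<bar>x\<bar>)"
      by (intro add_mono mult_left_mono that) simp_all
    also have "\<dots> = (\<bar>p\<bar> + \<bar>q\<bar>) * exp (c * \<bar>x\<bar>)"
      by (simp add: distrib_right)
    also have "\<dots> \<le> c * exp (c * \<bar>x\<bar>)"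
      by (intro mult_right_mono that) simp
    finally show ?thesis .
  qed
  have e: "\<bar>e * t\<bar> = \<bar>e\<bar> * t" "\<bar>e * t\<^sup>2\<bar> = \<bar>e\<bar> * t\<^sup>2"
    "0 \<le> \<bar>e\<bar> * t" "0 \<le> \<bar>e\<bar> * t\<^sup>2"
    using assms by (simp_all add: abs_mult)
  have "\<bar>f x\<bar> \<le> c * exp (c * \<bar>x\<bar>)" for x
    unfolding f_eq by (intro lin bounds) (use assms e in \<open>simp add: c_def\<close>)
  moreover have "\<bar>f' x\<bar> \<le> c * exp (c * \<bar>x\<bar>)" for x
    using lin[of 1 x "cosh (t * x)" "\<alpha> - \<kappa> * t" "e * t"] bounds[of x] assms e
    by (simp add: f'_def c_def)
  moreover have "\<bar>f'' x\<bar> \<le> c * exp (c * \<bar>x\<bar>)" for x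
    using lin[of 1 x "sinh (t * x)" 0 "e * t\<^sup>2"] bounds[of x] assms e
    by (simp add: f''_def c_def)
  moreover have "continuous_on UNIV f"
    using D DERIV_isCont by (auto simp: continuous_on_eq_continuous_at)
  ultimately show ?thesis
    using t twice unfolding regular_kernel_def f_def[symmetric] f' f''
    by (intro conjI exI[of _ c]) auto
qed

section \<open>The root \<open>s_plus\<close> and its line and disc\<close>

text \<open>For nonzero \<tau>, \<open>s\<close> is a root of \<open>A * s^2 + B * s + 1\<close>.
  Comparing \<open>R\<close> with \<open>B\<close> shows \<open>s < 0\<close>; comparing it with
  \<open>a * (u + \<gamma>) - \<tau>\<close> shows that \<open>s\<close> lies above
  \<open>- 1 / (a * \<gamma>)\<close>. Both comparisons reverse with the sign of \<tau>, as does the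
  division by it.\<close>

lemma quadratic_root:
  fixes a \<gamma> u \<tau> :: real
  assumes pos: "a > 0" "\<gamma> > 0" "u > 0"
  defines "s \<equiv> (if \<tau> = 0 then - 1 / (a * (u + \<gamma>))
      else (- a * (u + \<gamma>) - \<tau> + sqrt ((a * (u + \<gamma>) + \<tau>)\<^sup>2 - 4 * a * \<gamma> * \<tau>)) / (2 * a * \<gamma> * \<tau>))"
  shows "s < 0" and "1 + a * \<gamma> * s > 0" and "(1 + a * \<gamma> * s) * (1 + \<tau> * s) + a * u * s = 0"
proof -
  have "s < 0 \<and> 1 + a * \<gamma> * s > 0 \<and> (1 + a * \<gamma> * s) * (1 + \<tau> * s) + a * u * s = 0"
  proof (cases "\<tau> = 0")
    case True
    define v where "v = u + \<gamma>"
    have v: "v > 0" "u = v - \<gamma>" and s: "s = - 1 / (a * v)"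
      using pos True by (simp_all add: s_def v_def)
    have "1 + a * \<gamma> * s = u / v" "a * u * s = - u / v"
      using pos(1) v(1) unfolding s v(2) by (simp_all add: field_simps)
    moreover have "s < 0"
      using pos(1) v(1) by (simp add: s)
    ultimately show ?thesis
      using pos v(1) True by simp
  next
    case False
    define B where "B = a * (u + \<gamma>) + \<tau>"
    define R where "R = sqrt (B\<^sup>2 - 4 * a * \<gamma> * \<tau>)"
    define A where "A = a * \<gamma> * \<tau>"
    have s: "2 * A * s = R - B" and A: "A \<noteq> 0"
      using pos False by (simp_all add: s_def R_def B_def A_def)
    have D: "B\<^sup>2 - 4 * a * \<gamma> * \<tau> = (a * (u + \<gamma>) - \<tau>)\<^sup>2 + 4 * a * u * \<tau>"
      by (simp add: B_def power2_eq_square algebra_simps)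
    have coeff_pos: "a * u > 0" "a * \<gamma> > 0" using pos by simp_all
    \<comment> \<open>This form of the discriminant is visibly nonnegative for positive \<tau>; for
      negative \<tau> the sign of \<open>A\<close> suffices.\<close>
    have D2: "B\<^sup>2 - 4 * a * \<gamma> * \<tau> = (a * u)\<^sup>2 + 2 * (a * u) * (a * \<gamma> + \<tau>) + (a * \<gamma> - \<tau>)\<^sup>2"
      by (simp add: B_def power2_eq_square algebra_simps)
    have D3: "B\<^sup>2 - 4 * a * \<gamma> * \<tau> = B\<^sup>2 - 4 * A" by (simp add: A_def)
    have nonneg: "B\<^sup>2 - 4 * A \<ge> 0"
    proof (cases "\<tau> > 0")
      case True
      then show ?thesis unfolding D3[symmetric] D2 using coeff_pos by simp
    next
      case neg: False
      then have "A < 0" using False coeff_pos by (simp add: A_def mult_pos_neg)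
      then show ?thesis using zero_le_power2[of B] by linarith
    qed
    then have R2: "R\<^sup>2 = B\<^sup>2 - 4 * A" and R: "R \<ge> 0"
      by (simp_all add: R_def A_def)
    have "4 * A * (A * s\<^sup>2 + B * s + 1) = (2 * A * s + B)\<^sup>2 - (B\<^sup>2 - 4 * A)"
      by (simp add: power2_eq_square algebra_simps)
    also have "\<dots> = 0" by (simp add: s R2)
    finally have root: "A * s\<^sup>2 + B * s + 1 = 0" using A by simp
    have eq: "(1 + a * \<gamma> * s) * (1 + \<tau> * s) + a * u * s = 0"
      using root by (simp add: A_def B_def power2_eq_square algebra_simps)
    \<comment> \<open>The root formula recentred at the endpoint
      \<open>- 1 / (a * \<gamma>)\<close>.\<close>
    have shift: "2 * \<tau> * (1 + a * \<gamma> * s) = R - (a * (u + \<gamma>) - \<tau>)"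
      using s by (simp add: A_def B_def algebra_simps)
    have R2': "R\<^sup>2 = (a * (u + \<gamma>) - \<tau>)\<^sup>2 + 4 * (a * u) * \<tau>"
      using D D3 R2 by simp
    show ?thesis
    proof (cases "\<tau> > 0")
      case True
      then have "A > 0" "B > 0" using coeff_pos by (simp_all add: A_def B_def distrib_left add_pos_pos)
      then have "R < B" using R2 by (intro power2_less_imp_less[of R B]) simp_all
      with s \<open>A > 0\<close> have "s < 0"
        by (metis diff_less_0_iff_less mult_pos_pos not_less zero_less_numeral mult_nonneg_nonneg less_imp_le)
      moreover have "R > a * (u + \<gamma>) - \<tau>"
        by (rule power2_less_imp_less[OF _ R]) (simp add: R2' True coeff_pos)
      with shift True have "1 + a * \<gamma> * s > 0"
        by (metis diff_gt_0_iff_gt mult_pos_pos zero_less_mult_pos zero_less_numeral)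
      ultimately show ?thesis using eq by simp
    next
      case neg: False
      then have t: "\<tau> < 0" using False by simp
      then have "A < 0" using coeff_pos by (simp add: A_def mult_pos_neg)
      then have "R > B"
        using R2 by (intro power2_less_imp_less[OF _ R]) simp_all
      with s \<open>A < 0\<close> have "s < 0"
        by (metis diff_gt_0_iff_gt mult_nonneg_nonpos mult_neg_pos zero_less_numeral not_less less_imp_le mult.commute)
      moreover have "R < a * (u + \<gamma>) - \<tau>"
      proof (rule power2_less_imp_less)
        show "R\<^sup>2 < (a * (u + \<gamma>) - \<tau>)\<^sup>2"
          using R2' t coeff_pos by (simp add: mult_pos_neg)
        show "0 \<le> a * (u + \<gamma>) - \<tau>"
          using t pos by (smt (verit) mult_pos_pos)
      qed
      with shift t have "1 + a * \<gamma> * s > 0"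
        by (smt (verit) mult_nonpos_nonpos mult_nonneg_nonneg)
      ultimately show ?thesis using eq by simp
    qed
  qed
  then show "s < 0" and "1 + a * \<gamma> * s > 0" and "(1 + a * \<gamma> * s) * (1 + \<tau> * s) + a * u * s = 0"
    by simp_all
qed

text \<open>In the coordinates \<open>X = a y / (1 - a \<gamma> y)\<close> and \<open>n y\<close>, where \<open>y = - s_plus\<close> and \<open>n\<^sup>2\<close> is the squared
  norm minus \<open>a\<^sup>2\<close>, the quadratic equation becomes a line and the condition on \<open>\<psi>'\<close> a disc.\<close>

lemma psi_deriv_pos_iff:
  assumes a: "hermite_coeff f 1 = a" "a > 0" and "\<gamma> > 0" "lam > 1"
  obtains X y where "X > 0" "y > 0" "1 - a * \<gamma> * y > 0" "X = a * y / (1 - a * \<gamma> * y)"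
    "(lam - 1) * X + tau f \<beta> lam * y = 1"
    "psi_deriv f \<gamma> (s_plus f \<gamma> \<beta> lam) > 0 \<longleftrightarrow> \<gamma> * (X\<^sup>2 + (gauss_inner f f - a\<^sup>2) * y\<^sup>2) < 1"
proof -
  define s where "s = s_plus f \<gamma> \<beta> lam"
  define y where "y = - s"
  define w where "w = 1 - a * \<gamma> * y"
  define X where "X = a * y / w"
  define \<tau> where "\<tau> = tau f \<beta> lam"
  have s_eq: "s = (if \<tau> = 0 then - 1 / (a * ((lam - 1) + \<gamma>))
      else (- a * ((lam - 1) + \<gamma>) - \<tau> + sqrt ((a * ((lam - 1) + \<gamma>) + \<tau>)\<^sup>2 - 4 * a * \<gamma> * \<tau>)) / (2 * a * \<gamma> * \<tau>))"
    unfolding s_def s_plus_def Let_def a \<tau>_def[symmetric] by (simp add: add_diff_eq add.commute)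
  have "lam - 1 > 0" using assms by simp
  note root = quadratic_root[OF \<open>a > 0\<close> \<open>\<gamma> > 0\<close> this, of \<tau>, folded s_eq]
  have y: "y > 0" and w: "w > 0" and eq: "w * (1 - \<tau> * y) = a * (lam - 1) * y"
    using root by (simp_all add: y_def w_def algebra_simps)
  have X: "X > 0" using y w a by (simp add: X_def)
  have "(lam - 1) * X + \<tau> * y = 1"
    using eq w by (simp add: X_def field_simps)
  moreover have "psi_deriv f \<gamma> s = (1 - \<gamma> * (X\<^sup>2 + (gauss_inner f f - a\<^sup>2) * y\<^sup>2)) / y\<^sup>2"
  proof -
    have s': "s\<^sup>2 = y\<^sup>2" "1 + a * \<gamma> * s = w" by (simp_all add: y_def w_def)
    have "a\<^sup>2 / w\<^sup>2 = X\<^sup>2 / y\<^sup>2" using y by (simp add: X_def power_divide power_mult_distrib)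
    then have "a\<^sup>2 * \<gamma> / w\<^sup>2 = \<gamma> * X\<^sup>2 / y\<^sup>2" by (metis mult.commute times_divide_eq_right)
    then have "psi_deriv f \<gamma> s = 1 / y\<^sup>2 - \<gamma> * X\<^sup>2 / y\<^sup>2 - \<gamma> * (gauss_inner f f - a\<^sup>2)"
      unfolding psi_deriv_def Let_def a gauss_norm_def s'
      by (simp add: gauss_inner_self_nonneg)
    then show ?thesis
      using y by (simp add: field_simps)
  qed
  then have "psi_deriv f \<gamma> s > 0 \<longleftrightarrow> \<gamma> * (X\<^sup>2 + (gauss_inner f f - a\<^sup>2) * y\<^sup>2) < 1"
    using y by (simp add: zero_less_divide_iff not_less)
  ultimately show thesis
    using that[of X y] X y w by (simp add: w_def X_def s_def \<tau>_def)
qed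

section \<open>Which \<open>lam\<close> can and do recover: the line against the disc\<close>

text \<open>For \<open>a > 0\<close>, the bound on \<open>tau\<close> weakens the line to a
  half-plane at distance \<open>1 / sqrt ((lam - 1)^2 + \<kappa>^2)\<close> from the origin, which
  has to meet the open disc of radius \<open>1 / sqrt \<gamma>\<close>. For \<open>a = 0\<close> the
  bound gives \<open>sqrt \<gamma> < \<kappa>\<close> directly.\<close>

lemma recovery_region_necessary:
  assumes "\<gamma> > 0" "\<beta> > 0" and f: "f \<in> L2_odd" and lam: "lam \<in> recovery_region f \<gamma> \<beta>"
  shows "\<gamma> < \<beta>\<^sup>2 * sinh (((lam - 1) / \<beta>)\<^sup>2)"
proof -
  define t where "t = (lam - 1) / \<beta>"
  define a where "a = hermite_coeff f 1"
  define n where "n = sqrt (gauss_inner f f - a\<^sup>2)"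
  define \<kappa> where "\<kappa> = \<beta> * sqrt (sinh (t\<^sup>2) - t\<^sup>2)"
  have L2: "gauss_L2 f"
    using f by (simp add: L2_odd_def gauss_L2_def)
  have n2: "n\<^sup>2 = gauss_inner f f - a\<^sup>2"
    using bessel[OF L2, of "{1}"] by (simp add: n_def a_def)
  have "sinh (t\<^sup>2) - t\<^sup>2 \<ge> 0"
    using real_le_x_sinh[of "t\<^sup>2"] by (cases "t = 0") (simp_all add: sinh_field_def exp_minus)
  \<comment> \<open>Here \<open>(lam - 1)^2 = \<beta>^2 * t^2\<close> cancels the linear term of
    \<kappa>^2.\<close>
  then have \<kappa>2: "(lam - 1)\<^sup>2 + \<kappa>\<^sup>2 = \<beta>\<^sup>2 * sinh (t\<^sup>2)"
    using \<open>\<beta> > 0\<close> by (simp add: \<kappa>_def t_def power_mult_distrib power_divide right_diff_distrib)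
  have tau: "tau f \<beta> lam \<le> \<kappa> * n"
    using tau_le[OF f \<open>\<beta> > 0\<close>, of lam] by (simp add: \<kappa>_def n_def a_def t_def mult_ac)
  have "lam > 1" using lam by (simp add: recovery_region_def)
  consider "a > 0" "psi_deriv f \<gamma> (s_plus f \<gamma> \<beta> lam) > 0"
    | "a = 0" "tau f \<beta> lam > sqrt \<gamma> * gauss_norm f"
    using lam by (auto simp: recovery_region_def a_def)
  then have "\<gamma> < (lam - 1)\<^sup>2 + \<kappa>\<^sup>2"
  proof cases
    case 1
    obtain X y where "X > 0" "y > 0" and line: "(lam - 1) * X + tau f \<beta> lam * y = 1"
      and disc: "\<gamma> * (X\<^sup>2 + (n * y)\<^sup>2) < 1"
      using psi_deriv_pos_iff[OF a_def[symmetric] 1(1) \<open>\<gamma> > 0\<close> \<open>lam > 1\<close>, of \<beta>] 1(2)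
      unfolding n2[symmetric] power_mult_distrib by metis
    have "tau f \<beta> lam * y \<le> \<kappa> * n * y"
      using tau \<open>y > 0\<close> by simp
    then have "1 \<le> (lam - 1) * X + \<kappa> * (n * y)"
      using line by (simp add: mult.assoc)
    then have "1 \<le> ((lam - 1) * X + \<kappa> * (n * y))\<^sup>2"
      by simp
    also have "\<dots> \<le> ((lam - 1)\<^sup>2 + \<kappa>\<^sup>2) * (X\<^sup>2 + (n * y)\<^sup>2)"
      \<comment> \<open>Lagrange's identity: this square is the gap in Cauchy-Schwarz.\<close>
      using zero_le_power2[of "(lam - 1) * (n * y) - \<kappa> * X"]
      by (simp add: power2_eq_square algebra_simps)
    finally have le: "1 \<le> ((lam - 1)\<^sup>2 + \<kappa>\<^sup>2) * (X\<^sup>2 + (n * y)\<^sup>2)" .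
    have "X\<^sup>2 + (n * y)\<^sup>2 > 0"
      using \<open>X > 0\<close> by (simp add: add_pos_nonneg)
    moreover have "\<gamma> * (X\<^sup>2 + (n * y)\<^sup>2) < ((lam - 1)\<^sup>2 + \<kappa>\<^sup>2) * (X\<^sup>2 + (n * y)\<^sup>2)"
      using le disc by linarith
    ultimately show ?thesis
      by (simp add: mult_less_cancel_right)
  next
    case 2
    then have "gauss_norm f = n" by (simp add: gauss_norm_def n_def)
    moreover have "n \<ge> 0" using n2 2 gauss_inner_self_nonneg[of f] by (simp add: n_def)
    moreover have "sqrt \<gamma> * n < \<kappa> * n" using 2 tau \<open>gauss_norm f = n\<close> by simp
    ultimately have "sqrt \<gamma> < \<kappa>" by (simp add: mult_less_cancel_right)
    then have "\<gamma> < \<kappa>\<^sup>2"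
      using \<open>\<gamma> > 0\<close> power_strict_mono[of "sqrt \<gamma>" \<kappa> 2] by simp
    then show ?thesis
      using zero_le_power2[of "lam - 1"] by linarith
  qed
  then show ?thesis
    by (simp add: \<kappa>2 t_def)
qed

text \<open>Equality in the two Cauchy--Schwarz estimates behind \<open>recovery_region_necessary\<close> dictates
  the coefficient of \<open>x\<close>.\<close>

lemma recovery_region_optimal:
  fixes \<gamma> \<beta> t :: real
  assumes "\<gamma> > 0" "\<beta> > 0" "t > 0" and crit: "\<beta>\<^sup>2 * sinh (t\<^sup>2) = \<gamma>" and lam: "lam > 1 + \<beta> * t"
  shows "lam \<in> recovery_region (sinh_kernel (\<beta> * t / (1 + \<beta> * t)) \<beta> t) \<gamma> \<beta>"
proof -
  define u where "u = \<beta> * t"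
  \<comment> \<open>At the critical value the line touches the disc at
    \<open>X = u / \<gamma>\<close>, \<open>y = 1 / \<gamma>\<close>. Inserting this point into the
    relation between \<open>X\<close> and \<open>y\<close> gives
    \<open>a / (1 - a) = u\<close>.\<close>
  define a where "a = u / (1 + u)"
  \<comment> \<open>At the critical value, \<open>k\<close> is at once \<kappa>^2, the squared norm
    of \<open>f\<close> minus \<open>a^2\<close>, and \<open>tau\<close>.\<close>
  define k where "k = \<beta>\<^sup>2 * (sinh (t\<^sup>2) - t\<^sup>2)"
  define f where "f = sinh_kernel a \<beta> t"
  have u: "u > 0" using assms by (simp add: u_def)
  have u2: "u\<^sup>2 + k = \<gamma>"
    using crit by (simp add: k_def u_def right_diff_distrib power_mult_distrib)
  have a: "a > 0" "hermite_coeff f 1 = a"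
    using u by (simp_all add: a_def f_def hermite_coeff_sinh_kernel)
  have lu: "lam - 1 > u" "lam > 1" using lam u by (simp_all add: u_def)
  have n: "gauss_inner f f - a\<^sup>2 = k"
    by (simp add: f_def gauss_inner_sinh_kernel k_def)
  have k: "k \<ge> 0"
    using real_le_x_sinh[of "t\<^sup>2"] \<open>t > 0\<close> by (simp add: k_def sinh_field_def exp_minus)
  \<comment> \<open>\<open>sinh x - x\<close> is nondecreasing, so \<open>tau\<close> never drops
    below its critical value.\<close>
  have tau: "tau f \<beta> lam \<ge> k"
  proof -
    have "t\<^sup>2 \<le> (lam - 1) / \<beta> * t"
    proof -
      have "t \<le> (lam - 1) / \<beta>"
        using lu \<open>\<beta> > 0\<close> by (simp add: u_def field_simps)
      then show ?thesis
        using \<open>t > 0\<close> unfolding power2_eq_square by (intro mult_right_mono) simp_all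
    qed
    then have "sinh (t\<^sup>2) - t\<^sup>2 \<le> sinh ((lam - 1) / \<beta> * t) - (lam - 1) / \<beta> * t"
    proof (rule DERIV_nonneg_imp_nondecreasing)
      show "\<exists>y. ((\<lambda>x. sinh x - x) has_real_derivative y) (at x) \<and> 0 \<le> y" for x :: real
        by (rule exI[of _ "cosh x - 1"]) (auto intro!: derivative_eq_intros simp: cosh_real_ge_1)
    qed
    then show ?thesis
      unfolding f_def tau_sinh_kernel[OF \<open>\<beta> > 0\<close>] k_def power2_eq_square[of \<beta>]
      by (rule mult_left_mono) simp
  qed
  obtain X y where "X > 0" "y > 0" and w: "1 - a * \<gamma> * y > 0" and X: "X = a * y / (1 - a * \<gamma> * y)"
    and line: "(lam - 1) * X + tau f \<beta> lam * y = 1"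
    and disc: "psi_deriv f \<gamma> (s_plus f \<gamma> \<beta> lam) > 0 \<longleftrightarrow> \<gamma> * (X\<^sup>2 + k * y\<^sup>2) < 1"
    using psi_deriv_pos_iff[OF a(2,1) \<open>\<gamma> > 0\<close> \<open>lam > 1\<close>, of \<beta>] unfolding n by metis
  \<comment> \<open>Raising \<open>lam\<close> pushes the point strictly to the origin's side of the
    critical line.\<close>
  have line': "u * X + k * y < 1"
  proof -
    have "u * X < (lam - 1) * X" using lu \<open>X > 0\<close> by simp
    moreover have "k * y \<le> tau f \<beta> lam * y" using tau \<open>y > 0\<close> by simp
    ultimately show ?thesis using line by linarith
  qed
  have w': "(1 + u) * (1 - a * \<gamma> * y) = 1 + u - u * \<gamma> * y"
    using u by (simp add: a_def field_simps)
  have w'': "1 + u - u * \<gamma> * y > 0"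
    using w u unfolding w'[symmetric] by simp
  have X': "X * (1 + u - u * \<gamma> * y) = u * y"
    unfolding w'[symmetric] using w u by (simp add: X a_def)
  \<comment> \<open>If \<open>\<gamma> * y \<ge> 1\<close>, the factor of \<open>X\<close> in
    \<open>X'\<close> is at most 1, so \<open>X \<ge> u * y\<close>. Then
    \<open>u * X + k * y \<ge> \<gamma> * y \<ge> 1\<close>, against \<open>line'\<close>.\<close>
  have y: "\<gamma> * y < 1"
  proof (rule ccontr)
    assume "\<not> \<gamma> * y < 1"
    then have y1: "\<gamma> * y \<ge> 1" by simp
    have "u * (\<gamma> * y) \<ge> u" using y1 u by simp
    then have "X * (1 + u - u * \<gamma> * y) \<le> X * 1" using \<open>X > 0\<close> by (intro mult_left_mono) (simp_all add: mult.assoc)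
    then have "u * y \<le> X" using X' by simp
    then have "u * (u * y) \<le> u * X" using u by simp
    then have "(u\<^sup>2 + k) * y < 1" using line' by (simp add: power2_eq_square algebra_simps)
    then show False using y1 u2 by simp
  qed
  \<comment> \<open>Now the same factor is at least 1, which reverses the comparison and bounds the
    disc expression by \<open>(\<gamma> * y)^2\<close>.\<close>
  have "X \<le> u * y"
  proof -
    have "u * (\<gamma> * y) \<le> u" using y u by simp
    then have "X * 1 \<le> X * (1 + u - u * \<gamma> * y)" using \<open>X > 0\<close> by (intro mult_left_mono) (simp_all add: mult.assoc)
    then show ?thesis using X' by simp
  qed
  then have "X\<^sup>2 \<le> (u * y)\<^sup>2" using \<open>X > 0\<close> by (intro power_mono) simp_all
  then have "X\<^sup>2 + k * y\<^sup>2 \<le> (u\<^sup>2 + k) * y\<^sup>2" by (simp add: power_mult_distrib distrib_right)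
  then have "\<gamma> * (X\<^sup>2 + k * y\<^sup>2) \<le> \<gamma> * (\<gamma> * y\<^sup>2)" using u2 \<open>\<gamma> > 0\<close> by simp
  also have "\<dots> = (\<gamma> * y)\<^sup>2" by (simp add: power2_eq_square)
  also have "\<dots> < 1" using y \<open>y > 0\<close> \<open>\<gamma> > 0\<close> by (simp add: abs_square_less_1)
  finally show ?thesis
    using disc a lu unfolding recovery_region_def f_def a_def u_def by simp
qed

section \<open>The critical value and the optimal kernel\<close>

theorem corollary2p9:
  fixes \<gamma> \<beta> :: real
  assumes "\<gamma> > 0" and "\<beta> > 0"
  shows "\<exists>(fstar :: real \<Rightarrow> real) (g :: real \<Rightarrow> real) (lamstar :: real).
    fstar \<in> L2_odd \<and> regular_kernel fstar \<and>
    (\<Union>f\<in>L2_odd. recovery_region f \<gamma> \<beta>) = recovery_region fstar \<gamma> \<beta> \<and>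
    recovery_region fstar \<gamma> \<beta> = {lamstar<..} \<and>
    g \<in> L2_odd \<and>
    (\<forall>k. hermite_coeff g k =
       (if odd k \<and> k \<ge> 3 then (lamstar - 1) ^ k / (sqrt (fact k) * \<beta> ^ k) else 0)) \<and>
    (\<forall>x. fstar x = hermite_coeff fstar 1 * x + \<beta> * g x) \<and>
    (let t = (lamstar - 1) / \<beta> in
       \<forall>x. g x = exp (- t\<^sup>2 / 2) * sinh (t * x) - t * x)"
proof -
  \<comment> \<open>The positive solution of \<open>\<beta>^2 * sinh (t^2) = \<gamma>\<close>, where
    the necessary condition becomes an equality.\<close>
  define t where "t = sqrt (arsinh (\<gamma> / \<beta>\<^sup>2))"
  define lamstar where "lamstar = 1 + \<beta> * t"
  define fstar where "fstar = sinh_kernel (\<beta> * t / (1 + \<beta> * t)) \<beta> t"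
  define g where "g = sinh_kernel 0 1 t"
  have t: "t > 0" and t2: "t\<^sup>2 = arsinh (\<gamma> / \<beta>\<^sup>2)"
    using assms by (simp_all add: t_def less_imp_le)
  have crit: "\<beta>\<^sup>2 * sinh (t\<^sup>2) = \<gamma>"
    using assms by (simp add: t2)
  have lamstar: "(lamstar - 1) / \<beta> = t"
    using assms by (simp add: lamstar_def)
  have fstar: "fstar \<in> L2_odd"
    by (simp add: fstar_def sinh_kernel_L2_odd)
  have sub: "recovery_region f \<gamma> \<beta> \<subseteq> {lamstar<..}" if "f \<in> L2_odd" for f
  proof
    fix lam assume lam: "lam \<in> recovery_region f \<gamma> \<beta>"
    have "\<beta>\<^sup>2 * sinh (t\<^sup>2) < \<beta>\<^sup>2 * sinh (((lam - 1) / \<beta>)\<^sup>2)"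
      unfolding crit by (rule recovery_region_necessary[OF assms that lam])
    then have "t\<^sup>2 < ((lam - 1) / \<beta>)\<^sup>2"
      using assms by simp
    moreover have "(lam - 1) / \<beta> \<ge> 0"
      using lam assms by (simp add: recovery_region_def)
    ultimately have "t < (lam - 1) / \<beta>"
      by (rule power2_less_imp_less)
    then show "lam \<in> {lamstar<..}"
      using assms by (simp add: lamstar_def field_simps)
  qed
  moreover have sup: "{lamstar<..} \<subseteq> recovery_region fstar \<gamma> \<beta>"
    using recovery_region_optimal[OF assms t crit] by (auto simp: lamstar_def fstar_def)
  ultimately have region: "recovery_region fstar \<gamma> \<beta> = {lamstar<..}"
    using fstar by blast
  moreover have "(\<Union>f\<in>L2_odd. recovery_region f \<gamma> \<beta>) = recovery_region fstar \<gamma> \<beta>"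
    using sub fstar unfolding region by (auto simp: region)
  moreover have "hermite_coeff g k =
       (if odd k \<and> k \<ge> 3 then (lamstar - 1) ^ k / (sqrt (fact k) * \<beta> ^ k) else 0)" for k
  proof -
    \<comment> \<open>Index 1 is split off because the coefficient there is \<alpha>, which is 0 for
      \<open>g\<close>.\<close>
    have "odd k \<longleftrightarrow> k = 1 \<or> odd k \<and> k \<ge> 3" by (cases k) (auto elim!: evenE)
    then show ?thesis
      unfolding g_def hermite_coeff_sinh_kernel lamstar[symmetric]
      by (auto simp: power_divide mult.commute)
  qed
  moreover have "fstar x = hermite_coeff fstar 1 * x + \<beta> * g x" for x
    unfolding fstar_def hermite_coeff_sinh_kernel by (simp add: g_def sinh_kernel_def)
  moreover have "regular_kernel fstar"
    using t by (simp add: fstar_def regular_kernel_sinh_kernel)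
  moreover have "g \<in> L2_odd"
    by (simp add: g_def sinh_kernel_L2_odd)
  moreover have "let t = (lamstar - 1) / \<beta> in \<forall>x. g x = exp (- t\<^sup>2 / 2) * sinh (t * x) - t * x"
    unfolding lamstar by (simp add: g_def sinh_kernel_def)
  ultimately show ?thesis
    using fstar by blast
qed

end
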